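(* Let $u\in\Lambda$ be such that $R^s_u\neq\emptyset$. Then there exist $a>0$, $b\in(0,1)$ and $c\in\mathbb R$ such that: 1. $\{k\in\mathbb N: u_k>c\}\neq\emptyset$; 2. $u_k\le a b^k+c$ for all $k\in\mathbb N$; 3. $u_{K^s_u}=a b^{K^s_u}+c$.
   Context: $\mathbb N=\{0,1,2,\dots\}$. $\Lambda$ is the set of real sequences $u=(u_k)_{k\in\mathbb N}$ with $\sup_n u_n<+\infty$. For $u\in\mathbb R^{\mathbb N}$, $R^s_u:=\{k\in\mathbb N: u_k>\limsup_{n\to+\infty}u_n\}$ (the limsup may be $-\infty$), $\Delta^s_u:=\{k\in\mathbb N:\max_{0\le j\le k}u_j>\sup_{j>k}u_j\}$ and $K^s_u:=\inf\Delta^s_u$ (with $\inf\emptyset=+\infty$; for $u\in\Lambda$, $\Delta^s_u\ne\emptyset$ if and only if $R^s_u\neq\emptyset$). *)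

theory Defs
  imports Complex_Main "HOL-Library.Extended_Real" "HOL-Library.Extended_Nat"
begin

definition Lambda :: "(nat \<Rightarrow> real) set" where
  "Lambda = {u. (SUP n. ereal (u n)) < \<infinity>}"

definition R_s :: "(nat \<Rightarrow> real) \<Rightarrow> nat set" where
  "R_s u = {k. ereal (u k) > limsup (\<lambda>n. ereal (u n))}"

definition Delta_s :: "(nat \<Rightarrow> real) \<Rightarrow> nat set" where
  "Delta_s u = {k. ereal (Max (u ` {0..k})) > (SUP j\<in>{k<..}. ereal (u j))}"

text \<open>The infimum is taken in \<^typ>\<open>enat\<close>, so that it is \<open>\<infinity>\<close> when the set is empty.\<close>

definition K_s :: "(nat \<Rightarrow> real) \<Rightarrow> enat" where
  "K_s u = Inf (enat ` Delta_s u)"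

end

theory Submission imports Defs begin

text \<open>At the least element \<open>K\<close> of \<open>Delta_s u\<close>, the value \<open>u K\<close> dominates all
  earlier values and lies strictly above the supremum of the later ones. Hence a level \<open>c\<close>
  strictly in between and any \<open>b\<close> in the open unit interval work: with \<open>a\<close> chosen
  to give equality at \<open>K\<close>, the decreasing sequence \<open>a * b ^ k + c\<close> is at least \<open>u K\<close> up to \<open>K\<close>
  and at least \<open>c\<close> after.\<close>

text \<open>A level \<open>c\<close> strictly between the limsup and some \<open>u k\<close>
  eventually bounds the sequence. From an index \<open>m\<close> past both that point and
  \<open>k\<close>, the tail supremum is at most \<open>c\<close>, while the running maximum is at
  least \<open>u k\<close>.\<close>

lemma Delta_s_nonempty:
  assumes "R_s u \<noteq> {}"
  shows "Delta_s u \<noteq> {}"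
proof -
  obtain k where "limsup (\<lambda>n. ereal (u n)) < ereal (u k)"
    using assms by (auto simp: R_s_def)
  then obtain c where lim: "limsup (\<lambda>n. ereal (u n)) < ereal c" and ck: "ereal c < ereal (u k)"
    using ereal_dense2 by blast
  from Limsup_lessD[OF lim] obtain N where N: "\<And>n. n \<ge> N \<Longrightarrow> u n < c"
    by (auto simp: eventually_sequentially)
  define m where "m = max N k"
  have "(SUP j\<in>{m<..}. ereal (u j)) \<le> ereal c"
    using N by (intro SUP_least) (auto simp: m_def intro: less_imp_le)
  also note ck
  also have "ereal (u k) \<le> ereal (Max (u ` {0..m}))"
    by (simp add: m_def)
  finally show ?thesis
    by (auto simp: Delta_s_def)
qed

lemma K_s_eq_Least:
  assumes "Delta_s u \<noteq> {}"
  shows "K_s u = enat (LEAST k. k \<in> Delta_s u)"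
  unfolding K_s_def
proof (rule antisym)
  show "Inf (enat ` Delta_s u) \<le> enat (LEAST k. k \<in> Delta_s u)"
    using assms by (intro Inf_lower) (auto intro: LeastI)
  show "enat (LEAST k. k \<in> Delta_s u) \<le> Inf (enat ` Delta_s u)"
    by (intro Inf_greatest) (auto intro: Least_le)
qed

text \<open>If the maximum exceeded \<open>u K\<close>, it would be attained before
  \<open>K\<close>. It would then exceed the supremum from \<open>K\<close> on as well, which puts
  \<open>K - 1\<close> in \<open>Delta_s u\<close> against minimality.\<close>

lemma Max_eq_at_least_Delta_s:
  assumes K: "K \<in> Delta_s u" and least: "\<And>k. k \<in> Delta_s u \<Longrightarrow> K \<le> k"
  shows "Max (u ` {0..K}) = u K"
proof (cases K)
  case 0
  then show ?thesis by simp
next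
  case (Suc L)
  let ?S = "SUP j\<in>{K<..}. ereal (u j)"
  have split: "{0..K} = insert K {0..L}" "{L<..} = insert K {K<..}"
    using Suc by auto
  have MK: "Max (u ` {0..K}) = max (u K) (Max (u ` {0..L}))"
    unfolding split by simp
  have gap: "?S < ereal (Max (u ` {0..K}))"
    using K by (simp add: Delta_s_def)
  have "\<not> (SUP j\<in>{L<..}. ereal (u j)) < ereal (Max (u ` {0..L}))"
    using least[of L] Suc by (auto simp: Delta_s_def)
  then have "\<not> sup (ereal (u K)) ?S < ereal (Max (u ` {0..L}))"
    by (simp add: split)
  then show ?thesis
    using gap unfolding MK by (auto simp: sup_max max_def split: if_splits)
qed

theorem theorem1:
  fixes u :: "nat \<Rightarrow> real"
  assumes "u \<in> Lambda" and "R_s u \<noteq> {}"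
  shows "\<exists>a b c :: real. a > 0 \<and> b \<in> {0<..<1} \<and>
           {k. u k > c} \<noteq> {} \<and>
           (\<forall>k. u k \<le> a * b ^ k + c) \<and>
           (\<exists>K :: nat. K_s u = enat K \<and> u K = a * b ^ K + c)"
proof -
  define K where "K = (LEAST k. k \<in> Delta_s u)"
  have ne: "Delta_s u \<noteq> {}"
    using assms(2) by (rule Delta_s_nonempty)
  have K: "K \<in> Delta_s u"
    unfolding K_def using ne by (auto intro: LeastI)
  have max: "Max (u ` {0..K}) = u K"
    using K by (rule Max_eq_at_least_Delta_s) (auto simp: K_def intro: Least_le)
  have early: "u k \<le> u K" if "k \<le> K" for k
    unfolding max[symmetric] using that by simp
  obtain c where c: "(SUP j\<in>{K<..}. ereal (u j)) < ereal c" "c < u K"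
    using K ereal_dense2 max by (force simp: Delta_s_def)
  have late: "u k \<le> c" if "K < k" for k
    using that SUP_upper[of k "{K<..}" "\<lambda>j. ereal (u j)"] c(1)
    by (metis ereal_less_eq(3) greaterThan_iff less_imp_le order_trans)
  \<comment> \<open>This solves \<open>a * b ^ K + c = u K\<close> for the choice
    \<open>b = 1/2\<close>.\<close>
  define a where "a = (u K - c) * 2 ^ K"
  have a: "a > 0" using c(2) by (simp add: a_def)
  have aK: "u K = a * (1/2) ^ K + c"
    by (simp add: a_def power_divide)
  have "u k \<le> a * (1/2) ^ k + c" for k
  proof (cases "k \<le> K")
    case True
    then have "(1/2::real) ^ K \<le> (1/2) ^ k"
      by (intro power_decreasing) auto
    then have "a * (1/2) ^ K \<le> a * (1/2) ^ k"
      using a by (intro mult_left_mono) auto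
    then show ?thesis using early[OF True] aK by linarith
  next
    case False
    moreover have "0 < a * (1/2) ^ k" using a by simp
    ultimately show ?thesis using late[of k] by simp
  qed
  then show ?thesis
    \<comment> \<open>The \<open>exI\<close> instance says that some term exceeds \<open>c\<close>,
      with \<open>K\<close> as the witness.\<close>
    using a aK exI[of "\<lambda>k. c < u k", OF c(2)] K_s_eq_Least[OF ne]
    by - (rule exI[of _ a], rule exI[of _ "1/2"], rule exI[of _ c], auto simp: K_def)
qed

end
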